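(* Consider a causal model over a finite set $S$ of observed random variables, let $X,Y,Z,W\subseteq S$ be pairwise disjoint with $X,Y$ non-empty, and let $e_Z\in Z$. Then: 1. If $X\models Y\mid \mathrm{do}(Z)$ and $X\not\models Y\mid \mathrm{do}(Z\setminus\{e_Z\})$, then $e_Z$ is a cause of at least one element $e_Y\in Y$. 2. If $X\models Y\mid\{\mathrm{do}(Z),W\}$ and $X\not\models Y\mid\{\mathrm{do}(Z\setminus\{e_Z\}),W\}$, then $e_Z$ is a cause of at least one element $e_{YW}\in Y\cup W$.
   Context: Causal structure. A causal structure is a directed graph $\mathcal G$ whose nodes are either observed or unobserved; the observed nodes form a finite set $S$ of (discrete) random variables, while unobserved nodes may be arbitrary systems (classical, quantum, or of a generalized probabilistic theory). $\mathcal G$ may be cyclic. A node $N$ is a cause of a node $M$ if there is a directed path (with at least one edge) from $N$ to $M$. For disjoint node sets, $X$ and $Y$ are d-separated by $Z$ if every undirected path between an element of $X$ and an element of $Y$ is blocked by $Z$, i.e. contains a segment $A\to V\to B$ or $A\leftarrow V\to B$ with $V\in Z$, or a collider $A\to V\leftarrow B$ such that neither $V$ nor any descendant of $V$ is in $Z$. A distribution over the observed nodes is compatible with the graph if d-separation of disjoint observed sets $X,Y$ by observed $Z$ implies the conditional independence $P(XY|Z)=P(X|Z)P(Y|Z)$. Causal model and interventions. A causal model over $S$ is such a graph $\mathcal G$ with a compatible distribution $P_{\mathcal G}$ over $S$, together with intervention data: for $X\subseteq S$, the augmented graph $\mathcal G_{I_X}$ adds for each $e\in X$ a parentless observed node $I_e$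 with an edge $I_e\to e$ (values: "idle", or $\mathrm{do}(x)$ for values $x$ of $e$), and $\mathcal G_{\mathrm{do}(X)}$ is obtained from $\mathcal G_{I_X}$ by deleting all edges into $X$ other than those from $I_X$. Both carry compatible distributions with $P_{\mathcal G_{I_X}}(\cdot|I_X=\text{idle})=P_{\mathcal G}(\cdot)$, $P_{\mathcal G_{I_X}}(\cdot|I_X=\mathrm{do}(x))=P_{\mathcal G_{\mathrm{do}(X)}}(\cdot|I_X=\mathrm{do}(x))=P_{\mathcal G_{\mathrm{do}(X)}}(\cdot|X=x)$, and $I_X=\mathrm{do}(x)$ forces $X=x$. The same construction is applied to post-intervention models $\mathcal G_{\mathrm{do}(Z)}$ (intervening on $X$ there gives $\mathcal G_{\mathrm{do}(X\cup Z)}$). All conditional distributions that appear are assumed well-defined. Affects relations. For pairwise disjoint $X,Y,Z,W\subseteq S$ with $X,Y$ non-empty, $X\models Y\mid\{\mathrm{do}(Z),W\}$ holds if there exist values $x,z,w$ with $$P_{\mathcal G_{\mathrm{do}(X\cup Z)}}(Y| X=x,Z=z,W=w)\neq P_{\mathcal G_{\mathrm{do}(Z)}}(Y| Z=z,W=w);$$ otherwise $X\not\models Y\mid\{\mathrm{do}(Z),W\}$. When $W=\emptyset$ one writes $X\models Y\mid\mathrm{do}(Z)$. *)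

theory Defs
  imports "HOL-Probability.Probability"
begin

section \<open>Causal structures and d-separation\<close>

text \<open>Directed graphs, possibly cyclic and with self-loops. The unobserved nodes
  are \<open>nodes G - observed G\<close>; they carry no data, so they may stand for
  classical, quantum or post-quantum systems.\<close>

record 'a cgraph =
  nodes :: "'a set"
  observed :: "'a set"
  edges :: "('a \<times> 'a) set"

definition wf_cgraph :: "'a cgraph \<Rightarrow> bool" where
  "wf_cgraph G \<longleftrightarrow>
     finite (observed G) \<and> observed G \<subseteq> nodes G \<and> edges G \<subseteq> nodes G \<times> nodes G"

definition is_cause :: "'a cgraph \<Rightarrow> 'a \<Rightarrow> 'a \<Rightarrow> bool" where
  "is_cause G a b \<longleftrightarrow> (a, b) \<in> (edges G)\<^sup>+"

text \<open>An undirected path without repeated nodes, given by its nodes \<open>vs\<close> and by the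
  orientation \<open>ds ! i\<close> (\<open>True\<close> = forward) of the edge used between \<open>vs ! i\<close> and
  \<open>vs ! Suc i\<close>. The orientation has to be recorded because a cyclic graph may contain
  edges in both directions between two nodes.\<close>

definition undirected_path :: "'a cgraph \<Rightarrow> 'a list \<Rightarrow> bool list \<Rightarrow> bool" where
  "undirected_path G vs ds \<longleftrightarrow>
     length vs = Suc (length ds) \<and> distinct vs \<and> set vs \<subseteq> nodes G \<and>
     (\<forall>i < length ds.
        (if ds ! i then (vs ! i, vs ! Suc i) else (vs ! Suc i, vs ! i)) \<in> edges G)"

text \<open>The middle node of the segment \<open>vs ! i, vs ! (i+1), vs ! (i+2)\<close> is a collider iff
  the first edge is traversed forwards and the second one backwards. The chain with both
  edges backwards is the chain with both edges forwards, read from the other end.\<close>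

definition blocked :: "'a cgraph \<Rightarrow> 'a set \<Rightarrow> 'a list \<Rightarrow> bool list \<Rightarrow> bool" where
  "blocked G Z vs ds \<longleftrightarrow>
     (\<exists>i. Suc i < length ds \<and>
        (if ds ! i \<and> \<not> ds ! Suc i
         then \<forall>d. (vs ! Suc i, d) \<in> (edges G)\<^sup>* \<longrightarrow> d \<notin> Z
         else vs ! Suc i \<in> Z))"

definition d_separated :: "'a cgraph \<Rightarrow> 'a set \<Rightarrow> 'a set \<Rightarrow> 'a set \<Rightarrow> bool" where
  "d_separated G X Y Z \<longleftrightarrow>
     (\<forall>vs ds. undirected_path G vs ds \<and> hd vs \<in> X \<and> last vs \<in> Y \<longrightarrow> blocked G Z vs ds)"


section \<open>Compatible distributions\<close>

text \<open>A joint distribution of the observed nodes is a \<open>pmf\<close> on assignments of values to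
  these nodes. In what follows, \<open>cond_pmf p A\<close> is only meaningful if \<open>A\<close> meets the support
  of \<open>p\<close>, i.e. if \<open>A\<close> has positive probability.\<close>

definition possible :: "'w pmf \<Rightarrow> 'w set \<Rightarrow> bool" where
  "possible p A \<longleftrightarrow> measure_pmf.prob p A > 0"

definition marginal :: "('a \<Rightarrow> 'b) pmf \<Rightarrow> 'a set \<Rightarrow> ('a \<Rightarrow> 'b) pmf" where
  "marginal p N = map_pmf (\<lambda>\<omega>. restrict \<omega> N) p"

definition event :: "'a set \<Rightarrow> ('a \<Rightarrow> 'b) \<Rightarrow> ('a \<Rightarrow> 'b) set" where
  "event X x = {\<omega>. \<forall>i\<in>X. \<omega> i = x i}"

definition cond_indep ::
  "('a \<Rightarrow> 'b) pmf \<Rightarrow> 'a set \<Rightarrow> 'a set \<Rightarrow> 'a set \<Rightarrow> bool" where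
  "cond_indep p X Y Z \<longleftrightarrow>
     (\<forall>x y z. possible p (event Z z) \<longrightarrow>
        (let q = cond_pmf p (event Z z) in
         measure_pmf.prob q (event X x \<inter> event Y y) =
         measure_pmf.prob q (event X x) * measure_pmf.prob q (event Y y)))"

definition compatible :: "'a cgraph \<Rightarrow> ('a \<Rightarrow> 'b) pmf \<Rightarrow> bool" where
  "compatible G p \<longleftrightarrow>
     (\<forall>X Y Z. X \<subseteq> observed G \<and> Y \<subseteq> observed G \<and> Z \<subseteq> observed G \<and>
        X \<inter> Y = {} \<and> X \<inter> Z = {} \<and> Y \<inter> Z = {} \<and> d_separated G X Y Z \<longrightarrow>
        cond_indep p X Y Z)"


section \<open>Interventions\<close>

text \<open>\<open>Intv e\<close> is the intervention node of \<open>e\<close>.\<close>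

datatype 'n node = Var 'n | Intv 'n

datatype 'v nval = Val 'v | Idle | Do 'v

definition embed :: "'n cgraph \<Rightarrow> 'n node cgraph" where
  "embed G = \<lparr>nodes = Var ` nodes G, observed = Var ` observed G,
              edges = map_prod Var Var ` edges G\<rparr>"

definition augment :: "'n node cgraph \<Rightarrow> 'n set \<Rightarrow> 'n node cgraph" where
  "augment G X = \<lparr>nodes = nodes G \<union> Intv ` X, observed = observed G \<union> Intv ` X,
                  edges = edges G \<union> (\<lambda>e. (Intv e, Var e)) ` X\<rparr>"

definition do_graph :: "'n node cgraph \<Rightarrow> 'n set \<Rightarrow> 'n node cgraph" where
  "do_graph G X = augment G X
     \<lparr>edges := {(a, b) \<in> edges (augment G X). b \<in> Var ` X \<longrightarrow> a \<in> Intv ` X}\<rparr>"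

lemma do_graph_empty: "do_graph (embed G) {} = embed G"
  by (simp add: do_graph_def augment_def embed_def)

lemma do_graph_do_graph: "do_graph (do_graph (embed G) Z) X = do_graph (embed G) (X \<union> Z)"
  by (auto simp: do_graph_def augment_def embed_def)

definition var_event :: "'n set \<Rightarrow> ('n \<Rightarrow> 'v) \<Rightarrow> ('n node \<Rightarrow> 'v nval) set" where
  "var_event X x = {\<omega>. \<forall>e\<in>X. \<omega> (Var e) = Val (x e)}"

definition do_event :: "'n set \<Rightarrow> ('n \<Rightarrow> 'v) \<Rightarrow> ('n node \<Rightarrow> 'v nval) set" where
  "do_event X x = {\<omega>. \<forall>e\<in>X. \<omega> (Intv e) = Do (x e)}"

definition idle_event :: "'n set \<Rightarrow> ('n node \<Rightarrow> 'v nval) set" where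
  "idle_event X = {\<omega>. \<forall>e\<in>X. \<omega> (Intv e) = Idle}"

fun node_vals :: "('n \<Rightarrow> 'v set) \<Rightarrow> 'n node \<Rightarrow> 'v nval set" where
  "node_vals V (Var e) = Val ` V e"
| "node_vals V (Intv e) = insert Idle (Do ` V e)"

definition is_distribution ::
  "('n \<Rightarrow> 'v set) \<Rightarrow> 'n node cgraph \<Rightarrow> ('n node \<Rightarrow> 'v nval) pmf \<Rightarrow> bool" where
  "is_distribution V G p \<longleftrightarrow>
     set_pmf p \<subseteq> (\<Pi>\<^sub>E i \<in> observed G. node_vals V i) \<and> compatible G p"


section \<open>Causal models\<close>

text \<open>\<open>vals M e\<close> is the value set of the variable \<open>e\<close>. \<open>do_dist M Z\<close> is the distribution of
  $\mathcal{G}_{\mathrm{do}(Z)}$, so that \<open>do_dist M {}\<close> is $P_{\mathcal{G}}$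
  (cf. \<open>do_graph_empty\<close>). \<open>aug_dist M Z X\<close> is the distribution of
  $(\mathcal{G}_{\mathrm{do}(Z)})_{I_X}$.\<close>

record ('n, 'v) cmodel =
  graph :: "'n cgraph"
  vals :: "'n \<Rightarrow> 'v set"
  do_dist :: "'n set \<Rightarrow> ('n node \<Rightarrow> 'v nval) pmf"
  aug_dist :: "'n set \<Rightarrow> 'n set \<Rightarrow> ('n node \<Rightarrow> 'v nval) pmf"

text \<open>The conditions relating the model on $\mathcal{G}_{\mathrm{do}(Z)}$ to the intervention
  on \<open>X\<close> in it. Distributions with a dot, such as
  $P_{\mathcal{G}_{\mathrm{do}(Z)}}(\cdot)$, are over the observed nodes of
  $\mathcal{G}_{\mathrm{do}(Z)}$, the graph intervened on. The three \<open>possible\<close> conditions say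
  that the conditional distributions are well-defined.\<close>

definition intervention_rules :: "('n, 'v) cmodel \<Rightarrow> 'n set \<Rightarrow> 'n set \<Rightarrow> bool" where
  "intervention_rules M Z X \<longleftrightarrow>
     (let N = observed (do_graph (embed (graph M)) Z);
          pZ = do_dist M Z; pI = aug_dist M Z X; pD = do_dist M (X \<union> Z) in
      possible pI (idle_event X) \<and>
      marginal (cond_pmf pI (idle_event X)) N = pZ \<and>
      (\<forall>x \<in> (\<Pi>\<^sub>E e \<in> X. vals M e).
         possible pI (do_event X x) \<and> possible pD (do_event X x) \<and>
         possible pD (var_event X x) \<and>
         marginal (cond_pmf pI (do_event X x)) N = marginal (cond_pmf pD (do_event X x)) N \<and>
         marginal (cond_pmf pD (do_event X x)) N = marginal (cond_pmf pD (var_event X x)) N \<and>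
         set_pmf pI \<inter> do_event X x \<subseteq> var_event X x \<and>
         set_pmf pD \<inter> do_event X x \<subseteq> var_event X x))"

definition causal_model :: "('n, 'v) cmodel \<Rightarrow> bool" where
  "causal_model M \<longleftrightarrow>
     (let G = graph M; S = observed G in
      wf_cgraph G \<and>
      (\<forall>e\<in>S. countable (vals M e)) \<and>
      (\<forall>Z. Z \<subseteq> S \<longrightarrow>
         is_distribution (vals M) (do_graph (embed G) Z) (do_dist M Z)) \<and>
      (\<forall>Z X. Z \<subseteq> S \<and> X \<subseteq> S \<and> X \<inter> Z = {} \<longrightarrow>
         is_distribution (vals M) (augment (do_graph (embed G) Z) X) (aug_dist M Z X) \<and>
         intervention_rules M Z X))"


section \<open>Affects relations\<close>

text \<open>\<open>affects M X Y Z W\<close> is $X \models Y \mid \{\mathrm{do}(Z), W\}$. The values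
  range over those for which both conditional distributions are defined; by the positivity
  conditions above this only restricts \<open>w\<close>.\<close>

definition affects ::
  "('n, 'v) cmodel \<Rightarrow> 'n set \<Rightarrow> 'n set \<Rightarrow> 'n set \<Rightarrow> 'n set \<Rightarrow> bool" where
  "affects M X Y Z W \<longleftrightarrow>
     (\<exists>x \<in> (\<Pi>\<^sub>E e \<in> X. vals M e). \<exists>z \<in> (\<Pi>\<^sub>E e \<in> Z. vals M e). \<exists>w \<in> (\<Pi>\<^sub>E e \<in> W. vals M e).
        let A = var_event X x \<inter> var_event Z z \<inter> var_event W w;
            B = var_event Z z \<inter> var_event W w in
        possible (do_dist M (X \<union> Z)) A \<and> possible (do_dist M Z) B \<and>
        marginal (cond_pmf (do_dist M (X \<union> Z)) A) (Var ` Y) \<noteq>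
        marginal (cond_pmf (do_dist M Z) B) (Var ` Y))"

abbreviation affects_do ::
  "('n, 'v) cmodel \<Rightarrow> 'n set \<Rightarrow> 'n set \<Rightarrow> 'n set \<Rightarrow> bool" where
  "affects_do M X Y Z \<equiv> affects M X Y Z {}"

end

theory Submission
  imports Defs
begin

text \<open>Suppose \<open>e\<^sub>Z\<close> causes nothing in \<open>Y \<union> W\<close>, and let \<open>T\<close> be \<open>Z - {e\<^sub>Z}\<close>, with or without \<open>X\<close>.
  In the graph obtained from $\mathcal{G}_{\mathrm{do}(T)}$ by adding the node \<open>Intv e\<^sub>Z\<close>, a path
  from \<open>Intv e\<^sub>Z\<close> to \<open>Y \<union> W\<close> cannot be directed, so it has a first collider. This collider
  has no descendant in \<open>T\<close>, as the only parents of \<open>T\<close> are the parentless intervention nodes.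
  Hence \<open>T\<close> separates \<open>Intv e\<^sub>Z\<close> from \<open>Y \<union> W\<close>, and comparing the values \<open>Idle\<close> and \<open>Do\<close> of
  \<open>Intv e\<^sub>Z\<close> shows that, given the values of \<open>T\<close> and \<open>W\<close>, intervening on \<open>e\<^sub>Z\<close> does not change
  the distribution of \<open>Y\<close>. So both sides of the affects relation are unchanged when \<open>e\<^sub>Z\<close> is
  removed from \<open>Z\<close>.\<close>

section \<open>Conditioning and marginals of discrete distributions\<close>

lemma possible_iff: "possible p A \<longleftrightarrow> set_pmf p \<inter> A \<noteq> {}"
  by (simp add: possible_def zero_less_measure_iff measure_pmf_zero_iff)

lemma prob_cond_pmf:
  assumes "possible p A"
  shows "measure_pmf.prob (cond_pmf p A) B = measure_pmf.prob p (A \<inter> B) / measure_pmf.prob p A"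
proof -
  have "emeasure (measure_pmf p) A \<noteq> 0"
    using assms by (simp add: possible_def measure_pmf.emeasure_eq_measure)
  then show ?thesis
    using assms by (simp add: possible_iff cond_pmf.rep_eq measure_uniform_measure)
qed

lemma possible_cond_pmf:
  assumes "possible p A"
  shows "possible (cond_pmf p A) B \<longleftrightarrow> possible p (A \<inter> B)"
  using assms by (simp add: possible_iff set_cond_pmf Int_assoc)

lemma cond_pmf_cond_pmf:
  assumes "possible p (A \<inter> B)"
  shows "cond_pmf (cond_pmf p A) B = cond_pmf p (A \<inter> B)"
proof (rule pmf_eqI)
  fix \<omega>
  have A: "possible p A"
    using assms by (auto simp: possible_iff)
  then have "possible (cond_pmf p A) B"
    using assms by (simp add: possible_cond_pmf)
  note cond = pmf_cond[OF A[unfolded possible_iff]] pmf_cond[OF this[unfolded possible_iff]]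
    pmf_cond[OF assms[unfolded possible_iff]]
  show "pmf (cond_pmf (cond_pmf p A) B) \<omega> = pmf (cond_pmf p (A \<inter> B)) \<omega>"
    using A by (simp add: cond prob_cond_pmf) (simp add: possible_def)
qed

lemma marginal_marginal: "N' \<subseteq> N \<Longrightarrow> marginal (marginal p N) N' = marginal p N'"
  by (simp add: marginal_def pmf.map_comp o_def restrict_restrict Int_absorb1 Int_commute)

lemma event_restrict: "C \<subseteq> N \<Longrightarrow> (\<lambda>\<omega>. restrict \<omega> N) -` event C c = event C c"
  by (auto simp: event_def)

lemma possible_marginal:
  assumes "C \<subseteq> N"
  shows "possible (marginal p N) (event C c) \<longleftrightarrow> possible p (event C c)"
  using event_restrict[OF assms, of c] by (simp add: possible_def marginal_def)

lemma cond_marginal: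
  assumes "C \<subseteq> N" and "possible p (event C c)"
  shows "cond_pmf (marginal p N) (event C c) = marginal (cond_pmf p (event C c)) N"
  using assms(2) event_restrict[OF assms(1), of c]
  by (simp add: marginal_def possible_iff cond_map_pmf)

text \<open>Marginals are carried by assignments that are \<open>undefined\<close> outside
  \<open>N\<close>, hence the case distinction. On these, comparing marginals reduces to comparing
  probabilities of events.\<close>

lemma pmf_marginal:
  "pmf (marginal p N) y = (if y \<in> extensional N then measure_pmf.prob p (event N y) else 0)"
proof -
  have "(\<lambda>\<omega>. restrict \<omega> N) -` {y} = (if y \<in> extensional N then event N y else {})"
    by (auto simp: event_def extensional_def restrict_def fun_eq_iff)
  then show ?thesis
    by (simp add: marginal_def pmf_map)
qed

text \<open>Condition on \<open>event Z z\<close> first and on \<open>event X x\<close> second: in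
  the product rule the positive probability of \<open>event X x\<close> cancels.\<close>

lemma cond_indep_marginal:
  assumes "cond_indep p X Y Z" and pos: "possible p (event X x \<inter> event Z z)"
  shows "marginal (cond_pmf p (event X x \<inter> event Z z)) Y = marginal (cond_pmf p (event Z z)) Y"
proof (rule pmf_eqI)
  fix y
  let ?q = "cond_pmf p (event Z z)"
  have Z: "possible p (event Z z)"
    using pos by (auto simp: possible_iff)
  then have X: "possible ?q (event X x)"
    using pos by (simp add: possible_cond_pmf Int_commute)
  have "measure_pmf.prob ?q (event X x \<inter> event Y y) =
      measure_pmf.prob ?q (event X x) * measure_pmf.prob ?q (event Y y)"
    using assms(1) Z by (simp add: cond_indep_def Let_def)
  moreover have "cond_pmf p (event X x \<inter> event Z z) = cond_pmf ?q (event X x)"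
    using pos by (simp add: cond_pmf_cond_pmf Int_commute)
  ultimately show "pmf (marginal (cond_pmf p (event X x \<inter> event Z z)) Y) y = pmf (marginal ?q Y) y"
    using X by (simp add: pmf_marginal prob_cond_pmf possible_def)
qed

text \<open>This and the next two equations make the lemmas on \<open>event\<close> applicable. The
  dummy \<open>Idle\<close> branch is never inspected, as only \<open>Var\<close> nodes are
  indexed.\<close>

lemma var_event_eq: "var_event X x = event (Var ` X) (case_node (Val \<circ> x) (\<lambda>_. Idle))"
  by (auto simp: var_event_def event_def)

lemma do_event_eq: "do_event X x = event (Intv ` X) (case_node (\<lambda>_. Idle) (Do \<circ> x))"
  by (auto simp: do_event_def event_def)

lemma idle_event_eq: "idle_event X = event (Intv ` X) (\<lambda>_. Idle)"
  by (auto simp: idle_event_def event_def)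

lemma var_event_cong: "(\<And>i. i \<in> X \<Longrightarrow> x i = y i) \<Longrightarrow> var_event X x = var_event X y"
  by (auto simp: var_event_def)

section \<open>Separation of an intervention node from the non-effects of its target\<close>

lemma edges_augment_do_graph:
  "edges (augment (do_graph (embed G) T) X) =
     {(Var a, Var b) | a b. (a, b) \<in> edges G \<and> b \<notin> T} \<union> {(Intv a, Var a) | a. a \<in> X \<union> T}"
  by (auto simp: do_graph_def augment_def embed_def)

lemma observed_do_graph: "observed (do_graph (embed G) T) = Var ` observed G \<union> Intv ` T"
  by (simp add: do_graph_def augment_def embed_def)

lemma d_separated_augment_do_graph:
  assumes "e \<notin> T" and "e \<notin> Q" and no_cause: "\<And>q. q \<in> Q \<Longrightarrow> \<not> is_cause G e q"
  shows "d_separated (augment (do_graph (embed G) T) {e}) {Intv e} (Var ` Q) (Var ` T)"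
  unfolding d_separated_def
proof (intro allI impI, elim conjE)
  fix vs ds
  let ?H = "augment (do_graph (embed G) T) {e}"
  assume path: "undirected_path ?H vs ds" and "hd vs \<in> {Intv e}" and "last vs \<in> Var ` Q"
  then obtain q where q: "q \<in> Q" "last vs = Var q" and len: "length vs = Suc (length ds)"
    and dist: "distinct vs" and start: "vs ! 0 = Intv e"
    by (cases vs) (auto simp: undirected_path_def)
  have last: "vs ! length ds = Var q"
    using q len last_conv_nth[of vs] by (cases "vs = []") auto
  have fwd: "(vs ! i, vs ! Suc i) \<in> edges ?H" if "i < length ds" "ds ! i" for i
    using path that by (auto simp: undirected_path_def)
  have bwd: "(vs ! Suc i, vs ! i) \<in> edges ?H" if "i < length ds" "\<not> ds ! i" for i
    using path that unfolding undirected_path_def by (metis (full_types))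
  have no_parent: "(a, Intv b) \<notin> edges ?H" for a b
    by (auto simp: edges_augment_do_graph)
  have parent_T: "a = Intv t" if "(a, Var t) \<in> edges ?H" "t \<in> T" for a t
    using that by (auto simp: edges_augment_do_graph)
  \<comment> \<open>A path of forward edges only would enter \<open>Var e\<close> and then follow
    edges of \<open>G\<close>, so that \<open>q\<close> would be \<open>e\<close> itself or an
    effect of \<open>e\<close>.\<close>
  have "\<exists>i < length ds. \<not> ds ! i"
  proof (rule ccontr)
    assume *: "\<not> ?thesis"
    have reach: "\<exists>u. vs ! Suc k = Var u \<and> (e, u) \<in> (edges G)\<^sup>*" if "k < length ds" for k
      using that
    proof (induction k)
      case 0
      then show ?case using fwd[of 0] * start by (auto simp: edges_augment_do_graph)
    next
      case (Suc k)
      then obtain u where "vs ! Suc k = Var u" "(e, u) \<in> (edges G)\<^sup>*"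
        by auto
      then show ?case using fwd[of "Suc k"] Suc.prems *
        by (auto simp: edges_augment_do_graph intro: rtrancl_into_rtrancl)
    qed
    have "ds \<noteq> []"
      using start last by auto
    then have "(e, q) \<in> (edges G)\<^sup>*"
      using reach[of "length ds - 1"] last by auto
    then show False
      using q(1) no_cause[of q] \<open>e \<notin> Q\<close> by (auto simp: is_cause_def rtrancl_eq_or_trancl)
  qed
  \<comment> \<open>At the first backward edge, \<open>vs ! i\<close> is a collider:
    \<open>Intv e\<close> has no parents, so a forward edge precedes. \<open>blocked\<close> indexes
    a segment by its first node, hence \<open>i = Suc j\<close>.\<close>
  then obtain i where i: "i < length ds" "\<not> ds ! i" and least: "\<And>j. j < i \<Longrightarrow> ds ! j"
    using exists_least_iff[of "\<lambda>i. i < length ds \<and> \<not> ds ! i"] by auto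
  have "i \<noteq> 0"
    using bwd[OF i] start no_parent by metis
  then obtain j where j: "i = Suc j"
    by (cases i) auto
  have in1: "(vs ! j, vs ! i) \<in> edges ?H"
    using fwd[of j] least[of j] i j by simp
  have in2: "(vs ! Suc i, vs ! i) \<in> edges ?H"
    using bwd[OF i] .
  \<comment> \<open>If the collider were \<open>Var t\<close> itself, both its neighbours on the
    path would be its sole parent \<open>Intv t\<close>, against distinctness. If it were a proper
    ancestor of \<open>Var t\<close>, it would be the parentless \<open>Intv t\<close>, yet a
    collider has parents.\<close>
  have "d \<notin> Var ` T" if d: "(vs ! i, d) \<in> (edges ?H)\<^sup>*" for d
  proof
    assume "d \<in> Var ` T"
    then obtain t where t: "d = Var t" "t \<in> T" by auto
    from d show False
    proof (cases rule: rtranclE)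
      case base
      then have "vs ! j = vs ! Suc i"
        using in1 in2 t parent_T by metis
      then show False
        using dist len i j by (simp add: nth_eq_iff_index_eq)
    next
      case (step c)
      then have "(vs ! i, Intv t) \<in> (edges ?H)\<^sup>*"
        using parent_T t by metis
      then have "vs ! i = Intv t"
        by (cases rule: rtranclE) (use no_parent in auto)
      then show False
        using in1 no_parent by metis
    qed
  qed
  then show "blocked ?H (Var ` T) vs ds"
    unfolding blocked_def using i j least[of j] by (intro exI[of _ j]) auto
qed

section \<open>One further intervention, seen from the non-effects of its target\<close>

lemma causal_model_rules:
  assumes "causal_model M" and "Z \<subseteq> observed (graph M)" and "X \<subseteq> observed (graph M)"
    and "X \<inter> Z = {}"
  shows "intervention_rules M Z X"
  using assms by (simp add: causal_model_def Let_def)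

text \<open>Positivity comes from the rules for intervening on \<open>T\<close> in the original
  graph. Membership in \<open>Pi\<close> rather than \<open>PiE\<close> lets one assignment
  \<open>t\<close> serve for both \<open>T\<close> and \<open>insert e T\<close>.\<close>

lemma possible_do_dist:
  assumes "causal_model M" and "T \<subseteq> observed (graph M)" and "t \<in> Pi T (vals M)"
  shows "possible (do_dist M T) (var_event T t)"
proof -
  have "restrict t T \<in> (\<Pi>\<^sub>E e \<in> T. vals M e)"
    using assms(3) by auto
  then have "possible (do_dist M (T \<union> {})) (var_event T (restrict t T))"
    using causal_model_rules[OF assms(1) _ assms(2), of "{}"]
    unfolding intervention_rules_def Let_def by blast
  then show ?thesis
    by (simp cong: var_event_cong)
qed

text \<open>Both sides are read off \<open>aug_dist M T {e}\<close>: its \<open>Do\<close> branch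
  gives the left side, its \<open>Idle\<close> branch the right one. By separation, neither branch
  differs on \<open>Q\<close> from conditioning on \<open>var_event T t\<close> alone.\<close>

lemma marginal_do_dist_insert:
  assumes M: "causal_model M" and T: "insert e T \<subseteq> observed (graph M)" and "e \<notin> T"
    and Q: "Q \<subseteq> observed (graph M)" "Q \<inter> insert e T = {}"
    and no_cause: "\<And>q. q \<in> Q \<Longrightarrow> \<not> is_cause (graph M) e q"
    and t: "t \<in> Pi (insert e T) (vals M)"
  shows "marginal (cond_pmf (do_dist M (insert e T)) (var_event (insert e T) t)) (Var ` Q) =
         marginal (cond_pmf (do_dist M T) (var_event T t)) (Var ` Q)"
proof -
  let ?N = "observed (do_graph (embed (graph M)) T)"
  let ?P = "aug_dist M T {e}" and ?A = "var_event T t" and ?V = "var_event {e} t"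
  let ?I = "idle_event {e}" and ?D = "do_event {e} t"
  have rules: "intervention_rules M T {e}"
    using causal_model_rules[OF M] T \<open>e \<notin> T\<close> by simp
  then have I: "possible ?P ?I" "marginal (cond_pmf ?P ?I) ?N = do_dist M T"
    by (simp_all add: intervention_rules_def Let_def)
  have "restrict t {e} \<in> (\<Pi>\<^sub>E i \<in> {e}. vals M i)"
    using t by auto
  moreover have "do_event {e} (restrict t {e}) = ?D" "var_event {e} (restrict t {e}) = ?V"
    by (simp_all add: do_event_def var_event_def)
  ultimately have D: "possible ?P ?D" "possible (do_dist M (insert e T)) ?V"
    and marg: "marginal (cond_pmf ?P ?D) ?N = marginal (cond_pmf (do_dist M (insert e T)) ?V) ?N"
    using rules unfolding intervention_rules_def Let_def insert_is_Un[of e T] by metis+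
  have QN: "Var ` Q \<subseteq> ?N" and AN: "Var ` T \<subseteq> ?N"
    using Q T by (auto simp: observed_do_graph)
  \<comment> \<open>An identity of marginals on \<open>?N\<close> survives further conditioning on
    \<open>?A\<close>, because \<open>?A\<close> only concerns nodes in \<open>?N\<close>.\<close>
  have transfer: "possible p (B \<inter> ?A) \<and>
      marginal (cond_pmf p (B \<inter> ?A)) (Var ` Q) = marginal (cond_pmf r ?A) (Var ` Q)"
    if "possible p B" "marginal (cond_pmf p B) ?N = r" "possible r ?A" for p B r
  proof -
    have "possible (cond_pmf p B) ?A"
      using that(2,3) unfolding var_event_eq[of T] by (auto simp: possible_marginal[OF AN])
    then have pos: "possible p (B \<inter> ?A)"
      using that(1) by (simp add: possible_cond_pmf)
    have "cond_pmf r ?A = marginal (cond_pmf (cond_pmf p B) ?A) ?N"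
      using \<open>possible (cond_pmf p B) ?A\<close> that(2) unfolding var_event_eq[of T]
      by (auto simp: cond_marginal[OF AN])
    then show ?thesis
      using pos by (simp add: cond_pmf_cond_pmf marginal_marginal[OF QN])
  qed
  have "compatible (augment (do_graph (embed (graph M)) T) {e}) ?P"
    using M T \<open>e \<notin> T\<close> by (simp add: causal_model_def is_distribution_def Let_def)
  moreover have "d_separated (augment (do_graph (embed (graph M)) T) {e})
      {Intv e} (Var ` Q) (Var ` T)"
    using d_separated_augment_do_graph[OF \<open>e \<notin> T\<close> _ no_cause] Q(2) by blast
  moreover have "observed (augment (do_graph (embed (graph M)) T) {e}) = insert (Intv e) ?N"
    by (simp add: augment_def)
  moreover have "Intv e \<notin> Var ` Q" "Intv e \<notin> Var ` T" "Var ` Q \<inter> Var ` T = {}"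
    using Q(2) by auto
  ultimately have indep: "cond_indep ?P {Intv e} (Var ` Q) (Var ` T)"
    unfolding compatible_def using QN AN by (simp add: subset_insertI2)
  have split: "var_event (insert e T) t = ?V \<inter> ?A"
    by (auto simp: var_event_def)
  have r1: "possible (do_dist M T) ?A"
    using possible_do_dist[OF M] T t by simp
  have "possible (do_dist M (insert e T)) (?V \<inter> ?A)"
    using possible_do_dist[OF M T t] split by simp
  then have "possible (cond_pmf (do_dist M (insert e T)) ?V) ?A"
    using D(2) by (simp add: possible_cond_pmf)
  then have r2: "possible (marginal (cond_pmf (do_dist M (insert e T)) ?V) ?N) ?A"
    unfolding var_event_eq[of T] by (simp add: possible_marginal[OF AN])
  \<comment> \<open>\<open>dD\<close> and \<open>dV\<close> share the same \<open>r\<close>; this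
    links the \<open>Do\<close> branch to the distribution after the intervention on
    \<open>e\<close>.\<close>
  note dI = transfer[OF I r1] and dD = transfer[OF D(1) marg r2] and dV = transfer[OF D(2) refl r2]
  have "marginal (cond_pmf ?P (?I \<inter> ?A)) (Var ` Q) = marginal (cond_pmf ?P ?A) (Var ` Q)"
    using dI[THEN conjunct1] unfolding idle_event_eq var_event_eq[of T]
    by (simp add: cond_indep_marginal[OF indep])
  moreover have "marginal (cond_pmf ?P (?D \<inter> ?A)) (Var ` Q) = marginal (cond_pmf ?P ?A) (Var ` Q)"
    using dD[THEN conjunct1] unfolding do_event_eq var_event_eq[of T]
    by (simp add: cond_indep_marginal[OF indep])
  ultimately show ?thesis
    using dI dD dV by (simp add: split)
qed

text \<open>The marginals on \<open>Y \<union> W\<close> agree jointly, so they may be conditioned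
  on the event for \<open>W\<close> before being reduced to \<open>Y\<close>. Positivity is carried
  over too, since \<open>affects\<close> demands it of its witnesses.\<close>

lemma cond_do_dist_insert:
  assumes M: "causal_model M" and T: "insert e T \<subseteq> observed (graph M)" and "e \<notin> T"
    and Q: "Y \<union> W \<subseteq> observed (graph M)" "(Y \<union> W) \<inter> insert e T = {}"
    and no_cause: "\<And>q. q \<in> Y \<union> W \<Longrightarrow> \<not> is_cause (graph M) e q"
    and t: "t \<in> Pi (insert e T) (vals M)"
    and pos: "possible (do_dist M (insert e T)) (var_event (insert e T) t \<inter> var_event W w)"
  shows "possible (do_dist M T) (var_event T t \<inter> var_event W w)"
    and "marginal (cond_pmf (do_dist M (insert e T)) (var_event (insert e T) t \<inter> var_event W w))
           (Var ` Y) =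
         marginal (cond_pmf (do_dist M T) (var_event T t \<inter> var_event W w)) (Var ` Y)"
proof -
  let ?q = "\<lambda>T. cond_pmf (do_dist M T) (var_event T t)" and ?C = "var_event W w"
  let ?QN = "Var ` (Y \<union> W) :: 'a node set"
  have eq: "marginal (?q (insert e T)) ?QN = marginal (?q T) ?QN"
    by (rule marginal_do_dist_insert[OF M T \<open>e \<notin> T\<close> Q no_cause t])
  have p1: "possible (do_dist M (insert e T)) (var_event (insert e T) t)"
    and p2: "possible (do_dist M T) (var_event T t)"
    using possible_do_dist[OF M] T t by simp_all
  have WQ: "Var ` W \<subseteq> ?QN" and YQ: "Var ` Y \<subseteq> ?QN"
    by auto
  have c1: "possible (?q (insert e T)) ?C"
    using pos p1 by (simp add: possible_cond_pmf)
  then have c2: "possible (?q T) ?C"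
    using eq unfolding var_event_eq[of W] by (metis possible_marginal[OF WQ])
  then show pos': "possible (do_dist M T) (var_event T t \<inter> ?C)"
    using p2 by (simp add: possible_cond_pmf)
  have "marginal (cond_pmf (?q (insert e T)) ?C) ?QN = marginal (cond_pmf (?q T) ?C) ?QN"
    using c1 c2 eq unfolding var_event_eq[of W] by (metis cond_marginal[OF WQ])
  then show "marginal (cond_pmf (do_dist M (insert e T)) (var_event (insert e T) t \<inter> ?C)) (Var ` Y) =
      marginal (cond_pmf (do_dist M T) (var_event T t \<inter> ?C)) (Var ` Y)"
    using pos pos' by (metis cond_pmf_cond_pmf marginal_marginal[OF YQ])
qed

section \<open>Removing a non-cause from the interventions of an affects relation\<close>

lemma affects_remove_intervention:
  assumes M: "causal_model M"
    and sub: "X \<union> Y \<union> Z \<union> W \<subseteq> observed (graph M)"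
    and disj: "X \<inter> Z = {}" "(Y \<union> W) \<inter> (X \<union> Z) = {}"
    and "e \<in> Z" and no_cause: "\<And>q. q \<in> Y \<union> W \<Longrightarrow> \<not> is_cause (graph M) e q"
    and aff: "affects M X Y Z W"
  shows "affects M X Y (Z - {e}) W"
proof -
  let ?Z = "Z - {e}"
  obtain x z w where x: "x \<in> (\<Pi>\<^sub>E i \<in> X. vals M i)" and z: "z \<in> (\<Pi>\<^sub>E i \<in> Z. vals M i)"
    and w: "w \<in> (\<Pi>\<^sub>E i \<in> W. vals M i)"
    and A: "possible (do_dist M (X \<union> Z)) (var_event X x \<inter> var_event Z z \<inter> var_event W w)"
    and B: "possible (do_dist M Z) (var_event Z z \<inter> var_event W w)"
    and neq: "marginal (cond_pmf (do_dist M (X \<union> Z))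
          (var_event X x \<inter> var_event Z z \<inter> var_event W w)) (Var ` Y) \<noteq>
        marginal (cond_pmf (do_dist M Z) (var_event Z z \<inter> var_event W w)) (Var ` Y)"
    using aff by (auto simp: affects_def Let_def)
  \<comment> \<open>The set \<open>X \<union> Z\<close> needs a single assignment; disjointness of
    \<open>X\<close> and \<open>Z\<close> makes the merge agree with both \<open>x\<close> and
    \<open>z\<close>.\<close>
  define t where "t i = (if i \<in> X then x i else z i)" for i
  have ins: "insert e ?Z = Z" "insert e (X \<union> ?Z) = X \<union> Z"
    using \<open>e \<in> Z\<close> by auto
  have split: "var_event (X \<union> Z') t = var_event X x \<inter> var_event Z' z" if "Z' \<subseteq> Z" for Z'
    using that disj(1) by (fastforce simp: var_event_def t_def)
  have t: "t \<in> Pi (insert e (X \<union> ?Z)) (vals M)" and z': "z \<in> Pi (insert e ?Z) (vals M)"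
    unfolding ins using x z by (auto simp: t_def PiE_iff)
  have A': "possible (do_dist M (insert e (X \<union> ?Z)))
      (var_event (insert e (X \<union> ?Z)) t \<inter> var_event W w)"
    unfolding ins using A by (simp add: split)
  have B': "possible (do_dist M (insert e ?Z)) (var_event (insert e ?Z) z \<inter> var_event W w)"
    unfolding ins by (rule B)
  have s: "insert e (X \<union> ?Z) \<subseteq> observed (graph M)" "insert e ?Z \<subseteq> observed (graph M)"
    "e \<notin> X \<union> ?Z" "e \<notin> ?Z" "Y \<union> W \<subseteq> observed (graph M)"
    "(Y \<union> W) \<inter> insert e (X \<union> ?Z) = {}" "(Y \<union> W) \<inter> insert e ?Z = {}"
    using sub disj \<open>e \<in> Z\<close> by auto
  note 1 = cond_do_dist_insert[OF M s(1,3,5,6) no_cause t A', unfolded ins split[OF order_refl]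
      split[OF Diff_subset]]
  note 2 = cond_do_dist_insert[OF M s(2,4,5,7) no_cause z' B', unfolded ins]
  \<comment> \<open>The new witness is \<open>z\<close> made \<open>undefined\<close> at
    \<open>e\<close>, as \<open>PiE\<close> requires; \<open>x\<close> and \<open>w\<close> are
    kept.\<close>
  have "restrict z ?Z \<in> (\<Pi>\<^sub>E i \<in> ?Z. vals M i)"
    using z by auto
  moreover have "var_event ?Z (restrict z ?Z) = var_event ?Z z"
    by (rule var_event_cong) simp
  ultimately show ?thesis
    unfolding affects_def Let_def using x w 1 2 neq by metis
qed

theorem corollary2p35:
  fixes M :: "('n, 'v) cmodel" and X Y Z W :: "'n set" and e\<^sub>Z :: 'n
  assumes "causal_model M"
    and "X \<subseteq> observed (graph M)" and "Y \<subseteq> observed (graph M)"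
    and "Z \<subseteq> observed (graph M)" and "W \<subseteq> observed (graph M)"
    and "X \<inter> Y = {}" and "X \<inter> Z = {}" and "X \<inter> W = {}"
    and "Y \<inter> Z = {}" and "Y \<inter> W = {}" and "Z \<inter> W = {}"
    and "X \<noteq> {}" and "Y \<noteq> {}"
    and "e\<^sub>Z \<in> Z"
  shows "(affects_do M X Y Z \<and> \<not> affects_do M X Y (Z - {e\<^sub>Z}) \<longrightarrow>
           (\<exists>e\<^sub>Y \<in> Y. is_cause (graph M) e\<^sub>Z e\<^sub>Y)) \<and>
         (affects M X Y Z W \<and> \<not> affects M X Y (Z - {e\<^sub>Z}) W \<longrightarrow>
           (\<exists>e\<^sub>Y\<^sub>W \<in> Y \<union> W. is_cause (graph M) e\<^sub>Z e\<^sub>Y\<^sub>W))"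
proof -
  \<comment> \<open>Taking \<open>W'\<close> to be \<open>{}\<close> or \<open>W\<close> yields the
    two claims.\<close>
  have "\<exists>q \<in> Y \<union> W'. is_cause (graph M) e\<^sub>Z q"
    if "affects M X Y Z W'" "\<not> affects M X Y (Z - {e\<^sub>Z}) W'" "W' \<subseteq> W" for W'
  proof -
    have "X \<union> Y \<union> Z \<union> W' \<subseteq> observed (graph M)" "(Y \<union> W') \<inter> (X \<union> Z) = {}"
      using assms(2-11) that(3) by auto
    then show ?thesis
      using affects_remove_intervention[OF assms(1) _ assms(7) _ assms(14)] that(1,2) by metis
  qed
  from this[of "{}"] this[of W] show ?thesis
    by simp
qed

end
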